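(* Let $p\ge3$ be a prime and let $k_1,k_2$ be integers satisfying $k_1\ge0.4(p-1)$ and $k_2\ge0.4(p-1)$. Then the interval $\mathcal{I}=\{n\in\mathbb{Z}:\ -k_1\le n\le k_2\}\pmod p$ admits a nontrivial multiplicative decomposition.
   Context: $\mathbb{F}_p$ is the field of residues modulo the prime $p$. For $\mathcal{A},\mathcal{B}\subset\mathbb{F}_p$, $\mathcal{A}\mathcal{B}=\{ab:\ a\in\mathcal{A},\ b\in\mathcal{B}\}$. A set $\mathcal{S}\subset\mathbb{F}_p$ is said to admit (have) a nontrivial multiplicative decomposition if $\mathcal{S}\setminus\{0\}=\mathcal{A}\mathcal{B}$ for some sets $\mathcal{A},\mathcal{B}\subset\mathbb{F}_p$ with $|\mathcal{A}|\ge2$ and $|\mathcal{B}|\ge2$. *)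

theory Defs
  imports "HOL-Number_Theory.Residues" "HOL-Algebra.Coset"
begin

text \<open>
  The field of residues modulo a prime \<open>p\<close> is \<^term>\<open>residue_ring (int p)\<close>, with carrier
  \<^term>\<open>{0..int p - 1}\<close>; \<open><#>\<close> is the product of two subsets.
\<close>

definition nontrivial_mult_decomposition :: "nat \<Rightarrow> int set \<Rightarrow> bool" where
  "nontrivial_mult_decomposition p S \<longleftrightarrow>
    (\<exists>A B. A \<subseteq> carrier (residue_ring (int p)) \<and> B \<subseteq> carrier (residue_ring (int p)) \<and>
           card A \<ge> 2 \<and> card B \<ge> 2 \<and>
           S - {\<zero>\<^bsub>residue_ring (int p)\<^esub>} = A <#>\<^bsub>residue_ring (int p)\<^esub> B)"

definition interval_mod :: "nat \<Rightarrow> int \<Rightarrow> int \<Rightarrow> int set" where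
  "interval_mod p a b = (\<lambda>n. n mod int p) ` {n. a \<le> n \<and> n \<le> b}"

end

theory Submission
  imports Defs
begin

text \<open>
  Take \<open>A = {1, 2}\<close> and let \<open>B\<close> be the largest candidate, the nonzero \<open>x\<close> in the interval such
  that \<open>2x\<close> is again in the interval. Then \<open>AB\<close> is everything as soon as each \<open>n\<close> in the interval
  has its double or its half modulo \<open>p\<close> in the interval. If \<open>n\<close> is odd, its half is
  \<open>(n \<plusminus> p) / 2\<close>, with the sign opposite to that of \<open>n\<close>; when this falls outside the interval,
  \<open>\<bar>n\<bar>\<close> is below about \<open>p / 5\<close>, so \<open>2n\<close> is in the interval.
\<close>

lemma double_or_half_in_interval:
  fixes p k\<^sub>1 k\<^sub>2 n :: int
  assumes "odd p" "p > 0" "5 * k\<^sub>1 \<ge> 2 * p - 2" "5 * k\<^sub>2 \<ge> 2 * p - 2" "k\<^sub>1 \<ge> 0" "k\<^sub>2 \<ge> 0"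
    and n: "- k\<^sub>1 \<le> n" "n \<le> k\<^sub>2"
  shows "(- k\<^sub>1 \<le> 2 * n \<and> 2 * n \<le> k\<^sub>2) \<or> (\<exists>m. - k\<^sub>1 \<le> m \<and> m \<le> k\<^sub>2 \<and> [2 * m = n] (mod p))"
proof (cases "even n")
  case True
  then obtain m where "n = 2 * m" by blast
  then show ?thesis using assms by (intro disjI2 exI[of _ m]) auto
next
  case False
  with \<open>odd p\<close> obtain r s where r: "n - p = 2 * r" and s: "n + p = 2 * s"
    by (metis dvd_def odd_add even_diff)
  have "[2 * r = n] (mod p)" "[2 * s = n] (mod p)"
    using r s by (simp_all add: cong_iff_dvd_diff flip: r s)
  moreover have "(- k\<^sub>1 \<le> 2 * n \<and> 2 * n \<le> k\<^sub>2) \<or> (- k\<^sub>1 \<le> r \<and> r \<le> k\<^sub>2) \<or> (- k\<^sub>1 \<le> s \<and> s \<le> k\<^sub>2)"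
  proof (cases "n > 0")
    case True
    \<comment> \<open>Since \<open>r < n\<close>, the upper bound on \<open>r\<close> is automatic
      and only the lower one can fail.\<close>
    show ?thesis
    proof (cases "- k\<^sub>1 \<le> r")
      case True
      then show ?thesis using assms(2-) r \<open>n > 0\<close> by linarith
    next
      case False
      \<comment> \<open>By integrality \<open>2 * r\<close> is at most
        \<open>- 2 * k\<^sub>1 - 2\<close>, hence n \<le> p - 2 - 4(p - 1)/5 = (p - 6)/5 and 2n
        \<le> (2p - 12)/5, which is below \<open>k\<^sub>2\<close>.\<close>
      then have "- k\<^sub>1 \<le> 2 * n" "2 * n \<le> k\<^sub>2" using assms(2-) r \<open>n > 0\<close> by linarith+
      then show ?thesis by blast
    qed
  next
    case False
    \<comment> \<open>Mirror image: \<open>n \<le> s\<close> gives the lower bound, and if the upper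
      one fails then n \<ge> -(p - 6)/5.\<close>
    show ?thesis
    proof (cases "s \<le> k\<^sub>2")
      case True
      then show ?thesis using assms(2-) s \<open>\<not> n > 0\<close> by linarith
    next
      case False
      then have "- k\<^sub>1 \<le> 2 * n" "2 * n \<le> k\<^sub>2" using assms(2-) s \<open>\<not> n > 0\<close> by linarith+
      then show ?thesis by blast
    qed
  qed
  ultimately show ?thesis by blast
qed

lemma interval_mod_decomposition:
  fixes p :: nat and k\<^sub>1 k\<^sub>2 :: int
  assumes "odd p" "p \<ge> 3" "5 * k\<^sub>1 \<ge> 2 * int p - 2" "5 * k\<^sub>2 \<ge> 2 * int p - 2"
  shows "nontrivial_mult_decomposition p (interval_mod p (- k\<^sub>1) k\<^sub>2)"
proof -
  let ?S = "interval_mod p (- k\<^sub>1) k\<^sub>2"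
  define B where "B = {x \<in> ?S - {0}. (2 * x) mod int p \<in> ?S}"
  have p: "int p \<ge> 3" "odd (int p)" using assms by auto
  have k: "k\<^sub>1 \<ge> 1" "k\<^sub>2 \<ge> 1" using assms(3,4) p(1) by linarith+
  have S_carrier: "?S \<subseteq> {0..int p - 1}"
    using p by (auto simp: interval_mod_def)
  have in_S: "n mod int p \<in> ?S" if "- k\<^sub>1 \<le> n" "n \<le> k\<^sub>2" for n
    using that by (auto simp: interval_mod_def)
  \<comment> \<open>As 2 is invertible modulo the odd \<open>p\<close>, doubling an element of
    \<open>B\<close> never produces 0, so the product set stays inside
    \<open>?S - {0}\<close>.\<close>
  have double_ne_0: "(2 * x) mod int p \<noteq> 0" if "x \<in> ?S - {0}" for x
  proof
    assume "(2 * x) mod int p = 0"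
    with p have "int p dvd x"
      by (metis coprime_dvd_mult_right_iff coprime_right_2_iff_odd dvd_eq_mod_eq_0)
    moreover from that S_carrier have "0 < x" "x < int p" by force+
    ultimately show False by (auto dest: zdvd_imp_le)
  qed
  have "?S - {0} = {1, 2} <#>\<^bsub>residue_ring (int p)\<^esub> B"
  proof (intro equalityI subsetI)
    fix x assume x: "x \<in> ?S - {0}"
    then obtain n where n: "- k\<^sub>1 \<le> n" "n \<le> k\<^sub>2" "x = n mod int p"
      by (auto simp: interval_mod_def)
    have "x = x mod int p" by (simp add: n)
    consider "- k\<^sub>1 \<le> 2 * n" "2 * n \<le> k\<^sub>2"
      | m where "- k\<^sub>1 \<le> m" "m \<le> k\<^sub>2" "[2 * m = n] (mod int p)"
      using double_or_half_in_interval[of "int p" k\<^sub>1 k\<^sub>2 n] assms k n by fastforce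
    then show "x \<in> {1, 2} <#>\<^bsub>residue_ring (int p)\<^esub> B"
    \<comment> \<open>If the double of \<open>n\<close> stays in the interval, \<open>x\<close>
      itself lies in \<open>B\<close> and is 1 times itself. Otherwise \<open>x\<close> is 2 times
      its half \<open>?y\<close>, which lies in \<open>B\<close> because its double is
      \<open>x\<close>.\<close>
    proof cases
      case 1
      then have "(2 * x) mod int p \<in> ?S" using in_S[of "2 * n"] by (simp add: n mod_mult_right_eq)
      with x have "x \<in> B" by (simp add: B_def)
      with \<open>x = x mod int p\<close> show ?thesis
        by (auto simp: set_mult_def residue_ring_def)
    next
      case 2
      let ?y = "m mod int p"
      have y: "(2 * ?y) mod int p = x"
        using 2(3) by (simp add: n cong_def mod_mult_right_eq)
      with x have "?y \<noteq> 0" by auto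
      with y x in_S[OF 2(1,2)] have "?y \<in> B" by (simp add: B_def)
      with y show ?thesis
        by (force simp: set_mult_def residue_ring_def)
    qed
  next
    fix x assume "x \<in> {1, 2} <#>\<^bsub>residue_ring (int p)\<^esub> B"
    then obtain b where b: "b \<in> B" "x = b mod int p \<or> x = (2 * b) mod int p"
      by (auto simp: set_mult_def residue_ring_def)
    then have bS: "b \<in> ?S - {0}" "(2 * b) mod int p \<in> ?S" by (auto simp: B_def)
    then have "b mod int p = b" using S_carrier by (intro mod_pos_pos_trivial) auto
    moreover have "(2 * b) mod int p \<in> ?S - {0}" using bS(2) double_ne_0[OF bS(1)] by blast
    ultimately show "x \<in> ?S - {0}" using b(2) bS(1) by metis
  qed
  moreover have "card B \<ge> 2"
  proof -
    \<comment> \<open>This puts the residues of 1 and -1 in \<open>B\<close>; they differ because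
      \<open>p \<ge> 3\<close>. For \<open>p = 3\<close> the bounds only give
      \<open>k\<^sub>1, k\<^sub>2 \<ge> 1\<close>, but there 2 and -2 are congruent to -1 and 1.
      From \<open>p = 5\<close> on, 0.4(p - 1) \<ge> 1.6 rounds up to 2.\<close>
    have two: "2 mod int p \<in> ?S \<and> (- 2) mod int p \<in> ?S"
    proof (cases "p = 3")
      case True
      then show ?thesis using in_S[of "-1"] in_S[of 1] k by simp
    next
      case False
      then have "int p \<ge> 5" using p by presburger
      then have "k\<^sub>1 \<ge> 2" "k\<^sub>2 \<ge> 2" using assms(3,4) by linarith+
      then show ?thesis using in_S[of 2] in_S[of "-2"] by simp
    qed
    have m1: "(- 1) mod int p = int p - 1" using p by (simp add: zmod_minus1)
    have "2 * (int p - 1) mod int p = (- 2) mod int p"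
      by (simp add: mod_eq_dvd_iff)
    then have "{1, int p - 1} \<subseteq> B"
      using two in_S[of 1] in_S[of "-1"] k p m1 by (auto simp: B_def)
    moreover have "finite B"
      by (rule finite_subset[OF _ finite_atLeastAtMost_int]) (use S_carrier B_def in auto)
    ultimately show ?thesis
      using card_mono[of B "{1, int p - 1}"] p by auto
  qed
  moreover have "B \<subseteq> {0..int p - 1}" using S_carrier by (auto simp: B_def)
  moreover have "{1, 2} \<subseteq> {0..int p - 1}" "card {1, 2 :: int} \<ge> 2" using p by auto
  moreover have "carrier (residue_ring (int p)) = {0..int p - 1}" "\<zero>\<^bsub>residue_ring (int p)\<^esub> = 0"
    by (simp_all add: residue_ring_def)
  ultimately show ?thesis
    unfolding nontrivial_mult_decomposition_def by metis
qed

theorem theorem3: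
  fixes p :: nat and k\<^sub>1 k\<^sub>2 :: int
  assumes "prime p" and "p \<ge> 3"
    and "real_of_int k\<^sub>1 \<ge> 0.4 * (real p - 1)"
    and "real_of_int k\<^sub>2 \<ge> 0.4 * (real p - 1)"
  shows "nontrivial_mult_decomposition p (interval_mod p (- k\<^sub>1) k\<^sub>2)"
proof (rule interval_mod_decomposition)
  show "odd p" using assms(1,2) by (intro prime_odd_nat) auto
  \<comment> \<open>Multiplying by 5 turns the real bound into one between integers.\<close>
  have "2 * int p - 2 \<le> 5 * k" if "0.4 * (real p - 1) \<le> real_of_int k" for k
  proof -
    from that have "real_of_int (2 * int p - 2) \<le> real_of_int (5 * k)" by simp
    then show ?thesis by (simp only: of_int_le_iff)
  qed
  then show "5 * k\<^sub>1 \<ge> 2 * int p - 2" "5 * k\<^sub>2 \<ge> 2 * int p - 2"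
    using assms(3,4) by blast+
qed (fact assms(2))

end
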